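(* Let $0<\alpha_1\le\dots\le\alpha_r$ and $\Lambda=\Lambda(\alpha_1,\dots,\alpha_r)$. Then: (1) $w(\Lambda)=\alpha_r$; (2) $\Lambda$ equals the downwards closure of the convex hull of all coordinate permutations of the vector $(\alpha_1,\dots,\alpha_r)$; (3) for every $j\in[r]$, the slice $\{\mathbf x_{-j}:\mathbf x\in\Lambda,\ x_j=\alpha_r\}$ equals $\Lambda(\alpha_1,\dots,\alpha_{r-1})$; (4) for every $j\in[r]$, the projection $\Lambda_{[r]\setminus\{j\}}=\{\mathbf x_{-j}:\mathbf x\in\Lambda\}$ equals $\Lambda(\alpha_2,\dots,\alpha_r)$; (5) $\delta_{qk}(q\cdot\Lambda)=q^r\delta_k(\Lambda)$ for all $q,k>0$.
   Context: SIM-body: $\Lambda(\alpha_1,\dots,\alpha_r)=\{\mathbf x\in\mathbb R_+^r:\sum_{j\in J}x_j\le\sum_{j=r-|J|+1}^r\alpha_j\ \forall J\subseteq[r]\}$ (with $\Lambda()$ of the empty sequence being the single point of $\mathbb R^0$), and $q\cdot\Lambda(\alpha_1,\dots,\alpha_r)=\Lambda(q\alpha_1,\dots,q\alpha_r)$. The downwards closure of $S\subseteq\mathbb R_+^r$ is $\{\mathbf x\in\mathbb R_+^r:\exists\mathbf y\in S,\ \mathbf x\le\mathbf y\}$. The width of a symmetric body is the length of its projection onto any coordinate axis. For $k>0$ and an $r$-dimensional body $A$, $\delta_k(A)=|A|-k\sum_{j=1}^r|A_{[r]\setminus\{j\}}|$ with $|\cdot|$ Lebesgue measure of the relevant dimension.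 *)

theory Defs
  imports "HOL-Analysis.Analysis" "HOL-Library.Function_Algebras"
begin

text \<open>Points of R^r are modelled as functions nat => real that vanish outside {..<r}
  (coordinate i+1 of the paper is the value at i). To use the library convex hull we
  equip functions with the pointwise real vector space structure.\<close>

instantiation "fun" :: (type, real_vector) real_vector
begin
definition scaleR_fun :: "real \<Rightarrow> ('a \<Rightarrow> 'b) \<Rightarrow> 'a \<Rightarrow> 'b" where
  "scaleR_fun c f = (\<lambda>x. c *\<^sub>R f x)"
instance by standard (auto simp: scaleR_fun_def fun_eq_iff algebra_simps)
end

text \<open>The nonnegative orthant R_+^r.\<close>
definition orthant :: "nat \<Rightarrow> (nat \<Rightarrow> real) set" where
  "orthant r = {x. (\<forall>i. r \<le> i \<longrightarrow> x i = 0) \<and> (\<forall>i<r. 0 \<le> x i)}"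

text \<open>SIM-body Lambda(alpha_1,...,alpha_r), with alpha_(i+1) = alpha i.\<close>
definition SIM :: "nat \<Rightarrow> (nat \<Rightarrow> real) \<Rightarrow> (nat \<Rightarrow> real) set" where
  "SIM r \<alpha> = {x \<in> orthant r. \<forall>J \<subseteq> {..<r}. (\<Sum>j\<in>J. x j) \<le> (\<Sum>j\<in>{r - card J..<r}. \<alpha> j)}"

text \<open>Downwards closure of S in R_+^r.\<close>
definition down_closure :: "nat \<Rightarrow> (nat \<Rightarrow> real) set \<Rightarrow> (nat \<Rightarrow> real) set" where
  "down_closure r S = {x \<in> orthant r. \<exists>y\<in>S. x \<le> y}"

text \<open>All coordinate permutations of the vector (alpha_1,...,alpha_r).\<close>
definition coord_perms :: "nat \<Rightarrow> (nat \<Rightarrow> real) \<Rightarrow> (nat \<Rightarrow> real) set" where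
  "coord_perms r \<alpha> = {(\<lambda>i. if i < r then \<alpha> (\<sigma> i) else 0) | \<sigma>. \<sigma> permutes {..<r}}"

text \<open>x_{-j}: delete coordinate j (0-based), shifting later coordinates down.\<close>
definition del_coord :: "nat \<Rightarrow> (nat \<Rightarrow> real) \<Rightarrow> nat \<Rightarrow> real" where
  "del_coord j x = (\<lambda>i. if i < j then x i else x (Suc i))"

text \<open>Projection A_{[r] - {j}}.\<close>
definition proj_del :: "nat \<Rightarrow> (nat \<Rightarrow> real) set \<Rightarrow> (nat \<Rightarrow> real) set" where
  "proj_del j A = del_coord j ` A"

text \<open>r-dimensional Lebesgue measure of a body A in R^r.\<close>
definition vol :: "nat \<Rightarrow> (nat \<Rightarrow> real) set \<Rightarrow> real" where
  "vol r A = measure (Pi\<^sub>M {..<r} (\<lambda>_. lborel)) ((\<lambda>x. restrict x {..<r}) ` A)"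

text \<open>Length of the projection of A onto the j-th coordinate axis.\<close>
definition axis_length :: "(nat \<Rightarrow> real) set \<Rightarrow> nat \<Rightarrow> real" where
  "axis_length A j = measure lborel ((\<lambda>x. x j) ` A)"

text \<open>delta_k(A) = |A| - k * sum_j |A_{[r]-{j}}|.\<close>
definition delta :: "nat \<Rightarrow> real \<Rightarrow> (nat \<Rightarrow> real) set \<Rightarrow> real" where
  "delta r k A = vol r A - k * (\<Sum>j<r. vol (r - 1) (proj_del j A))"

end

theory Submission
  imports Defs
begin

text \<open>
  List the weights in decreasing order, \<open>v i = \<alpha> (r - 1 - i)\<close>; then the body is the set of
  \<open>x \<ge> 0\<close> whose sum over any \<open>k\<close> coordinates is at most \<open>v 0 + \<dots> + v (k - 1)\<close>.
  By the rearrangement inequality every permutation of \<open>v\<close> lies in this convex, downward closed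
  set, which gives one inclusion of (2). The other is proved by induction on the number of
  coordinates. A point with a zero coordinate or a tight proper subset \<open>J\<close> splits into a point of
  the body on \<open>J\<close> (with the largest weights) and one on the complement (with the remaining weights),
  and the sum of permutation vectors of the two parts is a permutation vector of the whole. Any
  other point lies strictly between two such boundary points on the line through it in a direction
  \<open>e\<^sub>a - e\<^sub>b\<close>. Parts (1), (3) and (4) follow by inserting or deleting a coordinate, and (5) from
  the homogeneity of the body and of Lebesgue measure.
\<close>

section \<open>SIM-bodies with decreasing weights\<close>

lemma scaleR_fun_apply [simp]: "(c *\<^sub>R f) i = c *\<^sub>R f i"
  by (simp add: scaleR_fun_def)

definition orthant_on :: "nat set \<Rightarrow> (nat \<Rightarrow> real) set" where
  "orthant_on I = {x. (\<forall>i. i \<notin> I \<longrightarrow> x i = 0) \<and> (\<forall>i\<in>I. 0 \<le> x i)}"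

lemma orthant_eq_orthant_on: "orthant r = orthant_on {..<r}"
  by (auto simp: orthant_def orthant_on_def not_less)

text \<open>The SIM-body with coordinates indexed by a finite set \<open>I\<close>, the weights listed in
  decreasing order, so that the sum of the \<open>k\<close> largest ones is \<open>sum v {..<k}\<close>.\<close>
definition sim_body :: "nat set \<Rightarrow> (nat \<Rightarrow> real) \<Rightarrow> (nat \<Rightarrow> real) set" where
  "sim_body I v = {x \<in> orthant_on I. \<forall>J\<subseteq>I. sum x J \<le> sum v {..<card J}}"

definition perm_vectors :: "nat set \<Rightarrow> (nat \<Rightarrow> real) \<Rightarrow> (nat \<Rightarrow> real) set" where
  "perm_vectors I v = {(\<lambda>i. if i \<in> I then v (\<sigma> i) else 0) | \<sigma>. bij_betw \<sigma> I {..<card I}}"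

definition perm_down_hull :: "nat set \<Rightarrow> (nat \<Rightarrow> real) \<Rightarrow> (nat \<Rightarrow> real) set" where
  "perm_down_hull I v = {x \<in> orthant_on I. \<exists>y\<in>convex hull perm_vectors I v. x \<le> y}"

definition decreasing_weights :: "nat \<Rightarrow> (nat \<Rightarrow> real) \<Rightarrow> bool" where
  "decreasing_weights n v \<longleftrightarrow> antimono_on {..<n} v \<and> (\<forall>i<n. 0 \<le> v i)"

lemma decreasing_weightsD:
  assumes "decreasing_weights n v"
  shows "\<And>i j. i \<le> j \<Longrightarrow> j < n \<Longrightarrow> v j \<le> v i" and "\<And>i. i < n \<Longrightarrow> 0 \<le> v i"
  using assms unfolding decreasing_weights_def monotone_on_def by auto

lemma decreasing_weights_mono: "decreasing_weights n v \<Longrightarrow> m \<le> n \<Longrightarrow> decreasing_weights m v"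
  unfolding decreasing_weights_def monotone_on_def by auto

lemma decreasing_weights_shift:
  "decreasing_weights n v \<Longrightarrow> decreasing_weights (n - k) (\<lambda>i. v (k + i))"
  unfolding decreasing_weights_def monotone_on_def by auto

lemma decreasing_weights_rev:
  assumes "0 \<le> \<alpha> 0" "\<And>i j. i \<le> j \<Longrightarrow> j < r \<Longrightarrow> \<alpha> i \<le> \<alpha> j"
  shows "decreasing_weights r (\<lambda>i. \<alpha> (r - 1 - i))"
  unfolding decreasing_weights_def monotone_on_def
  using assms(1) assms(2)[of 0] by (auto intro!: assms(2) order.trans[OF assms(1)])

lemma sum_atLeastLessThan_top:
  fixes \<beta> :: "nat \<Rightarrow> 'a::comm_monoid_add"
  shows "k \<le> n \<Longrightarrow> sum \<beta> {n - k..<n} = sum (\<lambda>i. \<beta> (n - 1 - i)) {..<k::nat}"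
proof (induction k)
  case (Suc k)
  have "{n - Suc k..<n} = insert (n - Suc k) {n - k..<n}" using Suc.prems by auto
  then show ?case using Suc by (simp add: add.commute)
qed simp

lemma SIM_eq_sim_body:
  assumes "\<And>i. i < n \<Longrightarrow> v i = \<beta> (n - 1 - i)"
  shows "SIM n \<beta> = sim_body {..<n} v"
proof -
  have "sum \<beta> {n - card J..<n} = sum v {..<card J}" if "J \<subseteq> {..<n}" for J
    using card_mono[OF _ that] assms by (simp add: sum_atLeastLessThan_top)
  then show ?thesis by (auto simp: SIM_def sim_body_def orthant_def orthant_on_def not_less)
qed

lemma bij_betw_reverse: "bij_betw (\<lambda>i. r - 1 - i) {..<r} {..<r::nat}"
  by (rule bij_betw_byWitness[where f'="\<lambda>i. r - 1 - i"]) auto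

lemma coord_perms_eq_perm_vectors:
  "coord_perms r \<alpha> = perm_vectors {..<r} (\<lambda>i. \<alpha> (r - 1 - i))"
proof (intro equalityI subsetI)
  fix p assume "p \<in> coord_perms r \<alpha>"
  then obtain \<sigma> where \<sigma>: "\<sigma> permutes {..<r}" and p: "p = (\<lambda>i. if i < r then \<alpha> (\<sigma> i) else 0)"
    unfolding coord_perms_def by blast
  define \<tau> where "\<tau> = (\<lambda>i. r - 1 - i) \<circ> \<sigma>"
  have "bij_betw \<tau> {..<r} {..<card {..<r}}"
    using bij_betw_trans[OF permutes_imp_bij[OF \<sigma>] bij_betw_reverse] by (simp add: \<tau>_def)
  moreover have "r - 1 - \<tau> i = \<sigma> i" if "i < r" for i
    using permutes_in_image[OF \<sigma>, of i] that by (simp add: \<tau>_def)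
  then have "p = (\<lambda>i. if i \<in> {..<r} then \<alpha> (r - 1 - \<tau> i) else 0)"
    by (auto simp: p fun_eq_iff)
  ultimately show "p \<in> perm_vectors {..<r} (\<lambda>i. \<alpha> (r - 1 - i))"
    unfolding perm_vectors_def by blast
next
  fix p assume "p \<in> perm_vectors {..<r} (\<lambda>i. \<alpha> (r - 1 - i))"
  then obtain \<tau> where \<tau>: "bij_betw \<tau> {..<r} {..<r}"
    and p: "p = (\<lambda>i. if i < r then \<alpha> (r - 1 - \<tau> i) else 0)"
    unfolding perm_vectors_def by auto
  define \<sigma> where "\<sigma> i = (if i < r then r - 1 - \<tau> i else i)" for i
  have "bij_betw \<sigma> {..<r} {..<r}"
    using bij_betw_trans[OF \<tau> bij_betw_reverse] by (rule bij_betw_cong[THEN iffD1, rotated]) (simp add: \<sigma>_def)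
  then have "\<sigma> permutes {..<r}" by (rule bij_imp_permutes) (simp add: \<sigma>_def)
  moreover have "p = (\<lambda>i. if i < r then \<alpha> (\<sigma> i) else 0)" by (auto simp: p \<sigma>_def fun_eq_iff)
  ultimately show "p \<in> coord_perms r \<alpha>" unfolding coord_perms_def by blast
qed

section \<open>The SIM-body is the down-closure of the permutohedron\<close>

lemma sum_le_sum_lessThan_card:
  fixes v :: "nat \<Rightarrow> 'a::linordered_idom"
  assumes A: "A \<subseteq> {..<n}" and v: "antimono_on {..<n} v"
  shows "sum v A \<le> sum v {..<card A}"
proof -
  let ?B = "{..<card A}"
  have fA: "finite A" using A finite_subset by blast
  have card_eq: "card (A - ?B) = card (?B - A)"
    using fA by (simp add: card_Diff_subset_Int Int_commute)
  have "sum v (A - ?B) \<le> sum v (?B - A)"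
  proof (cases "A - ?B = {}")
    case True
    then have "card (?B - A) = 0" using card_eq by (simp only: card.empty)
    then have "?B - A = {}" by (metis card_0_eq finite_Diff finite_lessThan)
    then show ?thesis using True by simp
  next
    case False
    then have "card A < n" using A by (auto simp: not_less)
    have "sum v (A - ?B) \<le> of_nat (card (A - ?B)) * v (card A)"
      using A v by (intro sum_bounded_above) (auto simp: monotone_on_def)
    also have "\<dots> = of_nat (card (?B - A)) * v (card A)"
      using card_eq by simp
    also have "\<dots> \<le> sum v (?B - A)"
      using v \<open>card A < n\<close> by (intro sum_bounded_below) (auto simp: monotone_on_def)
    finally show ?thesis .
  qed
  moreover have "sum v A = sum v (A \<inter> ?B) + sum v (A - ?B)"
    by (rule sum.Int_Diff[OF fA])
  moreover have "sum v ?B = sum v (A \<inter> ?B) + sum v (?B - A)"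
    using sum.Int_Diff[of ?B v A] by (simp add: Int_commute)
  ultimately show ?thesis by linarith
qed

lemma perm_vectors_subset_sim_body:
  assumes "decreasing_weights (card I) v"
  shows "perm_vectors I v \<subseteq> sim_body I v"
proof
  fix p assume "p \<in> perm_vectors I v"
  then obtain \<sigma> where \<sigma>: "bij_betw \<sigma> I {..<card I}" and p: "p = (\<lambda>i. if i \<in> I then v (\<sigma> i) else 0)"
    unfolding perm_vectors_def by blast
  have "sum p J \<le> sum v {..<card J}" if J: "J \<subseteq> I" for J
  proof -
    have inj: "inj_on \<sigma> J" using bij_betw_imp_inj_on[OF \<sigma>] J by (rule inj_on_subset)
    have "sum p J = sum v (\<sigma> ` J)"
      using J by (simp add: p sum.reindex[OF inj] subset_iff)
    also have "\<dots> \<le> sum v {..<card (\<sigma> ` J)}"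
      using bij_betw_imp_surj_on[OF \<sigma>] J assms
      by (intro sum_le_sum_lessThan_card) (auto simp: decreasing_weights_def)
    finally show ?thesis using card_image[OF inj] by simp
  qed
  moreover have "p \<in> orthant_on I"
    using bij_betwE[OF \<sigma>] decreasing_weightsD(2)[OF assms] by (auto simp: orthant_on_def p)
  ultimately show "p \<in> sim_body I v" unfolding sim_body_def by blast
qed

lemma convex_sim_body: "convex (sim_body I v)"
proof (rule convexI)
  fix x y :: "nat \<Rightarrow> real" and u w :: real
  assume x: "x \<in> sim_body I v" and y: "y \<in> sim_body I v" and uw: "0 \<le> u" "0 \<le> w" "u + w = 1"
  have "sum (u *\<^sub>R x + w *\<^sub>R y) J \<le> sum v {..<card J}" if "J \<subseteq> I" for J
  proof -
    have "sum (u *\<^sub>R x + w *\<^sub>R y) J = u * sum x J + w * sum y J"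
      by (simp add: sum.distrib sum_distrib_left)
    also have "\<dots> \<le> u * sum v {..<card J} + w * sum v {..<card J}"
      using x y that uw by (intro add_mono mult_left_mono) (auto simp: sim_body_def)
    finally show ?thesis using uw(3) by (simp flip: distrib_right)
  qed
  moreover have "u *\<^sub>R x + w *\<^sub>R y \<in> orthant_on I"
    using x y uw by (auto simp: sim_body_def orthant_on_def)
  ultimately show "u *\<^sub>R x + w *\<^sub>R y \<in> sim_body I v" unfolding sim_body_def by blast
qed

lemma convex_hull_perm_vectors_subset_sim_body:
  "decreasing_weights (card I) v \<Longrightarrow> convex hull perm_vectors I v \<subseteq> sim_body I v"
  by (intro hull_minimal perm_vectors_subset_sim_body convex_sim_body)

lemma perm_down_hull_subset_sim_body:
  assumes "decreasing_weights (card I) v"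
  shows "perm_down_hull I v \<subseteq> sim_body I v"
proof
  fix x assume "x \<in> perm_down_hull I v"
  then obtain y where x: "x \<in> orthant_on I" and y: "y \<in> sim_body I v" "x \<le> y"
    using convex_hull_perm_vectors_subset_sim_body[OF assms] unfolding perm_down_hull_def by blast
  have "sum x J \<le> sum v {..<card J}" if "J \<subseteq> I" for J
  proof -
    have "sum x J \<le> sum y J" using y(2) by (intro sum_mono) (simp add: le_fun_def)
    also have "\<dots> \<le> sum v {..<card J}" using y(1) that unfolding sim_body_def by blast
    finally show ?thesis .
  qed
  with x show "x \<in> sim_body I v" unfolding sim_body_def by blast
qed

lemma convex_perm_down_hull: "convex (perm_down_hull I v)"
proof (rule convexI)
  fix x x' :: "nat \<Rightarrow> real" and u w :: real
  assume "x \<in> perm_down_hull I v" "x' \<in> perm_down_hull I v" and uw: "0 \<le> u" "0 \<le> w" "u + w = 1"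
  then obtain y y' where x: "x \<in> orthant_on I" "y \<in> convex hull perm_vectors I v" "x \<le> y"
    and x': "x' \<in> orthant_on I" "y' \<in> convex hull perm_vectors I v" "x' \<le> y'"
    unfolding perm_down_hull_def by blast
  have "u *\<^sub>R y + w *\<^sub>R y' \<in> convex hull perm_vectors I v"
    using x(2) x'(2) uw by (intro convexD convex_convex_hull)
  moreover have "u *\<^sub>R x + w *\<^sub>R x' \<le> u *\<^sub>R y + w *\<^sub>R y'"
    using x(3) x'(3) uw by (auto simp: le_fun_def intro!: add_mono mult_left_mono)
  moreover have "u *\<^sub>R x + w *\<^sub>R x' \<in> orthant_on I"
    using x(1) x'(1) uw by (auto simp: orthant_on_def)
  ultimately show "u *\<^sub>R x + w *\<^sub>R x' \<in> perm_down_hull I v"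
    unfolding perm_down_hull_def by blast
qed

lemma perm_vectors_add_subset:
  assumes "finite J" "finite K" "J \<inter> K = {}"
  shows "perm_vectors J v + perm_vectors K (\<lambda>i. v (card J + i)) \<subseteq> perm_vectors (J \<union> K) v"
proof
  fix z assume "z \<in> perm_vectors J v + perm_vectors K (\<lambda>i. v (card J + i))"
  then obtain \<sigma> \<tau> where \<sigma>: "bij_betw \<sigma> J {..<card J}" and \<tau>: "bij_betw \<tau> K {..<card K}"
    and z: "z = (\<lambda>i. if i \<in> J then v (\<sigma> i) else 0) + (\<lambda>i. if i \<in> K then v (card J + \<tau> i) else 0)"
    unfolding perm_vectors_def set_plus_def by blast
  define \<rho> where "\<rho> i = (if i \<in> J then \<sigma> i else card J + \<tau> i)" for i
  have "bij_betw \<rho> J {..<card J}"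
    using \<sigma> by (rule bij_betw_cong[THEN iffD1, rotated]) (simp add: \<rho>_def)
  moreover have "bij_betw \<rho> K {card J..<card J + card K}"
  proof -
    have "bij_betw ((+) (card J) \<circ> \<tau>) K ((+) (card J) ` {..<card K})"
      by (rule bij_betw_trans[OF \<tau>]) (simp add: bij_betw_def)
    moreover have "(+) (card J) ` {..<card K} = {card J..<card J + card K}"
      by (simp add: lessThan_atLeast0 add.commute)
    ultimately have "bij_betw ((+) (card J) \<circ> \<tau>) K {card J..<card J + card K}" by simp
    then show ?thesis
      by (rule bij_betw_cong[THEN iffD1, rotated]) (use assms(3) in \<open>auto simp: \<rho>_def\<close>)
  qed
  ultimately have "bij_betw \<rho> (J \<union> K) ({..<card J} \<union> {card J..<card J + card K})"
    by (rule bij_betw_combine) auto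
  moreover have "{..<card J} \<union> {card J..<card J + card K} = {..<card (J \<union> K)}"
    using assms by (auto simp: card_Un_disjoint)
  moreover have "z = (\<lambda>i. if i \<in> J \<union> K then v (\<rho> i) else 0)"
    using assms(3) by (auto simp: z \<rho>_def fun_eq_iff)
  ultimately show "z \<in> perm_vectors (J \<union> K) v" unfolding perm_vectors_def by auto
qed

lemma perm_down_hull_add:
  assumes "finite J" "finite K" "J \<inter> K = {}"
    and u: "u \<in> perm_down_hull J v" and w: "w \<in> perm_down_hull K (\<lambda>i. v (card J + i))"
  shows "u + w \<in> perm_down_hull (J \<union> K) v"
proof -
  obtain y where u': "u \<in> orthant_on J" "y \<in> convex hull perm_vectors J v" "u \<le> y"
    using u unfolding perm_down_hull_def by blast
  obtain y' where w': "w \<in> orthant_on K"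
    "y' \<in> convex hull perm_vectors K (\<lambda>i. v (card J + i))" "w \<le> y'"
    using w unfolding perm_down_hull_def by blast
  have "y + y' \<in> convex hull (perm_vectors J v + perm_vectors K (\<lambda>i. v (card J + i)))"
    using u'(2) w'(2) by (simp add: convex_hull_set_plus set_plus_intro)
  also have "\<dots> \<subseteq> convex hull perm_vectors (J \<union> K) v"
    using perm_vectors_add_subset[OF assms(1-3)] by (rule hull_mono)
  finally have "y + y' \<in> convex hull perm_vectors (J \<union> K) v" .
  moreover have "u + w \<le> y + y'" using u'(3) w'(3) by (rule add_mono)
  moreover have "u + w \<in> orthant_on (J \<union> K)"
    using u'(1) w'(1) assms(3) by (auto simp: orthant_on_def)
  ultimately show ?thesis unfolding perm_down_hull_def by blast
qed

definition zero_outside :: "nat set \<Rightarrow> (nat \<Rightarrow> real) \<Rightarrow> nat \<Rightarrow> real" where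
  "zero_outside J x = (\<lambda>i. if i \<in> J then x i else 0)"

lemma orthant_on_split:
  "x \<in> orthant_on I \<Longrightarrow> J \<subseteq> I \<Longrightarrow> x = zero_outside J x + zero_outside (I - J) x"
  by (auto simp: orthant_on_def zero_outside_def fun_eq_iff)

lemma sum_zero_outside: "K \<subseteq> J \<Longrightarrow> sum (zero_outside J x) K = sum x K"
  by (intro sum.cong) (auto simp: zero_outside_def)

lemma sum_lessThan_add: "sum v {..<j + k} = sum v {..<j} + sum (\<lambda>i. v (j + i)) {..<k::nat}"
  by (induction k) (auto simp: add.assoc)

lemma zero_mem_sim_body:
  assumes "finite I" "decreasing_weights (card I) v"
  shows "0 \<in> sim_body I v"
proof -
  have "0 \<le> sum v {..<card J}" if "J \<subseteq> I" for J
    using card_mono[OF assms(1) that] decreasing_weightsD(2)[OF assms(2)] by (intro sum_nonneg) auto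
  then show ?thesis by (simp add: sim_body_def orthant_on_def)
qed

lemma zero_outside_mem_sim_body:
  assumes "x \<in> sim_body I v" "J \<subseteq> I"
  shows "zero_outside J x \<in> sim_body J v"
proof -
  have "sum (zero_outside J x) K \<le> sum v {..<card K}" if "K \<subseteq> J" for K
    using assms that unfolding sum_zero_outside[OF that] sim_body_def by auto
  moreover have "zero_outside J x \<in> orthant_on J"
    using assms by (auto simp: sim_body_def orthant_on_def zero_outside_def)
  ultimately show ?thesis unfolding sim_body_def by blast
qed

lemma zero_outside_mem_sim_body_complement:
  assumes "finite I" "x \<in> sim_body I v" "J \<subseteq> I" and tight: "sum x J = sum v {..<card J}"
  shows "zero_outside (I - J) x \<in> sim_body (I - J) (\<lambda>i. v (card J + i))"
proof -
  have "sum x K \<le> sum (\<lambda>i. v (card J + i)) {..<card K}" if K: "K \<subseteq> I - J" for K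
  proof -
    have fin: "finite J" "finite K" using assms(1,3) K by (auto intro: finite_subset)
    have disj: "J \<inter> K = {}" and "J \<union> K \<subseteq> I" using K assms(3) by auto
    have "sum x J + sum x K = sum x (J \<union> K)" using sum.union_disjoint[OF fin disj, of x] by simp
    also have "\<dots> \<le> sum v {..<card (J \<union> K)}"
      using assms(2) \<open>J \<union> K \<subseteq> I\<close> unfolding sim_body_def by blast
    also have "\<dots> = sum v {..<card J} + sum (\<lambda>i. v (card J + i)) {..<card K}"
      using card_Un_disjoint[OF fin disj] by (simp add: sum_lessThan_add)
    finally show ?thesis using tight by simp
  qed
  then have "sum (zero_outside (I - J) x) K \<le> sum (\<lambda>i. v (card J + i)) {..<card K}"
    if "K \<subseteq> I - J" for K
    using that by (simp add: sum_zero_outside)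
  moreover have "zero_outside (I - J) x \<in> orthant_on (I - J)"
    using zero_outside_mem_sim_body[OF assms(2), of "I - J"] by (simp add: sim_body_def)
  ultimately show ?thesis unfolding sim_body_def by blast
qed

lemma sim_body_subset_perm_down_hull_card_le_1:
  assumes "finite I" "card I \<le> 1"
  shows "sim_body I v \<subseteq> perm_down_hull I v"
proof
  fix x assume x: "x \<in> sim_body I v"
  obtain \<sigma> where \<sigma>: "bij_betw \<sigma> I {..<card I}"
    using finite_same_card_bij[OF assms(1), of "{..<card I}"] by auto
  define p where "p = (\<lambda>i. if i \<in> I then v (\<sigma> i) else 0)"
  have "p \<in> convex hull perm_vectors I v"
    using \<sigma> by (intro hull_inc) (auto simp: perm_vectors_def p_def)
  moreover have "x i \<le> p i" for i
  proof (cases "i \<in> I")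
    case True
    then have "\<sigma> i = 0" using bij_betwE[OF \<sigma>] assms(2) by fastforce
    moreover have "sum x {i} \<le> sum v {..<card {i}}" using x True unfolding sim_body_def by blast
    ultimately show ?thesis using True by (simp add: p_def)
  qed (use x in \<open>simp add: sim_body_def orthant_on_def p_def\<close>)
  ultimately show "x \<in> perm_down_hull I v"
    using x unfolding perm_down_hull_def sim_body_def le_fun_def by blast
qed

definition on_boundary :: "nat set \<Rightarrow> (nat \<Rightarrow> real) \<Rightarrow> (nat \<Rightarrow> real) \<Rightarrow> bool" where
  "on_boundary I v x \<longleftrightarrow> (\<exists>i\<in>I. x i = 0) \<or> (\<exists>J. J \<subset> I \<and> J \<noteq> {} \<and> sum x J = sum v {..<card J})"

lemma on_boundary_split:
  assumes "finite I" "2 \<le> card I" "decreasing_weights (card I) v"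
    and x: "x \<in> sim_body I v" "on_boundary I v x"
  obtains J where "J \<subset> I" "J \<noteq> {}" "zero_outside (I - J) x \<in> sim_body (I - J) (\<lambda>i. v (card J + i))"
  using x(2) unfolding on_boundary_def
proof (elim disjE bexE exE conjE)
  fix i assume i: "i \<in> I" "x i = 0"
  define J where "J = I - {i}"
  have "I \<noteq> {i}" using assms(2) by auto
  then have J: "J \<subset> I" "J \<noteq> {}" using i by (auto simp: J_def)
  have "I - J = {i}" using i by (auto simp: J_def)
  moreover have "card I - card J = 1" using assms(1,2) i by (simp add: J_def)
  ultimately have "0 \<in> sim_body (I - J) (\<lambda>j. v (card J + j))"
    using decreasing_weights_shift[OF assms(3), of "card J"] by (intro zero_mem_sim_body) simp_all
  moreover have "zero_outside (I - J) x = 0"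
    using i \<open>I - J = {i}\<close> by (auto simp: zero_outside_def)
  ultimately show thesis using that J by simp
next
  fix J assume "J \<subset> I" "J \<noteq> {}" "sum x J = sum v {..<card J}"
  then show thesis using that zero_outside_mem_sim_body_complement[OF assms(1) x(1)] by blast
qed

definition transfer :: "nat \<Rightarrow> nat \<Rightarrow> nat \<Rightarrow> real" where
  "transfer a b = (\<lambda>i. of_bool (i = a) - of_bool (i = b))"

lemma sum_transfer: "finite J \<Longrightarrow> sum (transfer a b) J = of_bool (a \<in> J) - of_bool (b \<in> J)"
  by (simp add: transfer_def sum_subtractf)

lemma transfer_swap: "transfer b a = - transfer a b"
  by (simp add: transfer_def fun_eq_iff)

text \<open>From an interior point, moving mass from \<open>b\<close> to \<open>a\<close> stays inside the body until either
  \<open>x b\<close> is exhausted or one of the constraints for sets containing \<open>a\<close> but not \<open>b\<close> becomes tight.\<close>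
lemma transfer_to_boundary:
  assumes "finite I" "x \<in> sim_body I v" "a \<in> I" "b \<in> I" "a \<noteq> b" "\<not> on_boundary I v x"
  obtains t where "t > 0" "x + t *\<^sub>R transfer a b \<in> sim_body I v"
    "on_boundary I v (x + t *\<^sub>R transfer a b)"
proof -
  define F where "F = {J. J \<subseteq> I \<and> a \<in> J \<and> b \<notin> J}"
  define slack where "slack J = sum v {..<card J} - sum x J" for J
  have "finite F" unfolding F_def using assms(1) by (auto intro: finite_subset[of _ "Pow I"])
  have "{a} \<in> F" using assms(3,5) by (simp add: F_def)
  have slack_pos: "slack J > 0" if "J \<in> F" for J
  proof -
    have "J \<subset> I" "J \<noteq> {}" using that assms(4) by (auto simp: F_def)
    then have "sum x J \<noteq> sum v {..<card J}" using assms(6) unfolding on_boundary_def by blast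
    moreover have "sum x J \<le> sum v {..<card J}"
      using assms(2) that by (auto simp: sim_body_def F_def)
    ultimately show ?thesis by (simp add: slack_def)
  qed
  define m where "m = Min (slack ` F)"
  have "m \<in> slack ` F" unfolding m_def using \<open>finite F\<close> \<open>{a} \<in> F\<close> by (intro Min_in) auto
  then have "m > 0" using slack_pos by auto
  have m_le: "m \<le> slack J" if "J \<in> F" for J unfolding m_def using \<open>finite F\<close> that by simp
  have "x b > 0" using assms(2,4,6) by (force simp: on_boundary_def sim_body_def orthant_on_def)
  define t where "t = min (x b) m"
  define z where "z = x + t *\<^sub>R transfer a b"
  have "t > 0" using \<open>x b > 0\<close> \<open>m > 0\<close> by (simp add: t_def)
  have sum_z: "sum z J = sum x J + t * (of_bool (a \<in> J) - of_bool (b \<in> J))" if "finite J" for J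
    using that by (simp add: z_def sum.distrib sum_distrib_left[symmetric] sum_transfer)
  have "sum z J \<le> sum v {..<card J}" if J: "J \<subseteq> I" for J
  proof (cases "J \<in> F")
    case True
    then have "t \<le> slack J" using m_le[of J] by (simp add: t_def)
    then show ?thesis
      using True sum_z[of J] J assms(1) by (auto simp: F_def slack_def finite_subset)
  next
    case False
    then show ?thesis using sum_z[of J] J assms(1,2) \<open>t > 0\<close>
      by (auto simp: F_def sim_body_def finite_subset)
  qed
  moreover have "z \<in> orthant_on I"
    using assms(2-5) \<open>t > 0\<close> by (auto simp: z_def transfer_def t_def sim_body_def orthant_on_def)
  moreover have "on_boundary I v z"
  proof (cases "t = x b")
    case True
    then have "z b = 0" using assms(5) by (simp add: z_def transfer_def)
    then show ?thesis using assms(4) by (auto simp: on_boundary_def)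
  next
    case False
    then have "t = m" by (simp add: t_def min_def split: if_splits)
    obtain J where "J \<in> F" "m = slack J" using \<open>m \<in> slack ` F\<close> by blast
    then have "J \<subset> I" "J \<noteq> {}" "sum z J = sum v {..<card J}"
      using sum_z[of J] assms(1,4) \<open>t = m\<close> by (auto simp: F_def slack_def finite_subset)
    then show ?thesis by (auto simp: on_boundary_def)
  qed
  ultimately show thesis using that \<open>t > 0\<close> by (simp add: z_def sim_body_def)
qed

lemma sim_body_subset_perm_down_hull:
  assumes "finite I" "decreasing_weights (card I) v"
  shows "sim_body I v \<subseteq> perm_down_hull I v"
  using assms
proof (induction "card I" arbitrary: I v rule: less_induct)
  case less
  show ?case
  proof (cases "card I \<le> 1")
    case True
    then show ?thesis using sim_body_subset_perm_down_hull_card_le_1 less.prems(1) by blast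
  next
    case False
    have boundary: "x \<in> perm_down_hull I v" if x: "x \<in> sim_body I v" "on_boundary I v x" for x
    proof -
      obtain J where J: "J \<subset> I" "J \<noteq> {}"
        and rest: "zero_outside (I - J) x \<in> sim_body (I - J) (\<lambda>i. v (card J + i))"
        using on_boundary_split[OF less.prems(1) _ less.prems(2) x] False by auto
      have fin: "finite J" "finite (I - J)" using J less.prems(1) by (auto intro: finite_subset)
      have "card J < card I" "card (I - J) = card I - card J" "0 < card J"
        using J fin less.prems(1) by (auto simp: psubset_card_mono card_Diff_subset card_gt_0_iff)
      then have card: "card J < card I" "card (I - J) = card I - card J" "card (I - J) < card I"
        by auto
      have "decreasing_weights (card J) v"
        using less.prems(2) card(1) by (simp add: decreasing_weights_mono)
      then have "zero_outside J x \<in> perm_down_hull J v"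
        using less.hyps[OF card(1) fin(1)] zero_outside_mem_sim_body[OF x(1)] J by blast
      moreover have "zero_outside (I - J) x \<in> perm_down_hull (I - J) (\<lambda>i. v (card J + i))"
        using less.hyps[OF card(3) fin(2)] decreasing_weights_shift[OF less.prems(2)] rest card(2)
        by auto
      ultimately have "zero_outside J x + zero_outside (I - J) x \<in> perm_down_hull (J \<union> (I - J)) v"
        using fin by (intro perm_down_hull_add) auto
      moreover have "J \<union> (I - J) = I" using J by auto
      ultimately show ?thesis
        using orthant_on_split[of x I J] x(1) J by (simp add: sim_body_def)
    qed
    show ?thesis
    proof
      fix x assume x: "x \<in> sim_body I v"
      show "x \<in> perm_down_hull I v"
      proof (cases "on_boundary I v x")
        case True
        then show ?thesis using boundary x by blast
      next
        case False
        obtain a b where ab: "a \<in> I" "b \<in> I" "a \<noteq> b"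
          using \<open>\<not> card I \<le> 1\<close> card_le_Suc0_iff_eq[OF less.prems(1)] by auto
        define d where "d = transfer a b"
        obtain t where t: "t > 0" "x + t *\<^sub>R d \<in> sim_body I v" "on_boundary I v (x + t *\<^sub>R d)"
          using transfer_to_boundary[OF less.prems(1) x ab False] unfolding d_def by blast
        obtain s where s: "s > 0" "x - s *\<^sub>R d \<in> sim_body I v" "on_boundary I v (x - s *\<^sub>R d)"
          using transfer_to_boundary[OF less.prems(1) x ab(2,1) ab(3)[symmetric] False]
          by (auto simp: d_def transfer_swap[of b a])
        let ?u = "s / (s + t)" and ?w = "t / (s + t)"
        have "?u + ?w = 1" using s t by (simp flip: add_divide_distrib)
        then have "?u *\<^sub>R (x + t *\<^sub>R d) + ?w *\<^sub>R (x - s *\<^sub>R d) \<in> perm_down_hull I v"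
          using s t boundary by (intro convexD[OF convex_perm_down_hull]) auto
        moreover have "?u *\<^sub>R (x + t *\<^sub>R d) + ?w *\<^sub>R (x - s *\<^sub>R d) = x"
          using s t by (simp add: algebra_simps flip: scaleR_add_left add_divide_distrib)
        ultimately show ?thesis by simp
      qed
    qed
  qed
qed

section \<open>Deleting a coordinate\<close>

definition skip :: "nat \<Rightarrow> nat \<Rightarrow> nat" where
  "skip j i = (if i < j then i else Suc i)"

definition insert_coord :: "nat \<Rightarrow> real \<Rightarrow> (nat \<Rightarrow> real) \<Rightarrow> nat \<Rightarrow> real" where
  "insert_coord j t y = (\<lambda>i. if i < j then y i else if i = j then t else y (i - 1))"

lemma del_coord_eq_comp_skip: "del_coord j x = x \<circ> skip j"
  by (auto simp: del_coord_def skip_def fun_eq_iff)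

lemma inj_skip: "inj (skip j)"
  by (auto simp: inj_def skip_def split: if_splits)

lemma skip_neq [simp]: "skip j i \<noteq> j"
  by (simp add: skip_def)

lemma skip_less_iff: "j < r \<Longrightarrow> skip j i < r \<longleftrightarrow> i < r - 1"
  by (auto simp: skip_def)

lemma del_coord_insert_coord [simp]: "del_coord j (insert_coord j t y) = y"
  by (auto simp: del_coord_def insert_coord_def fun_eq_iff)

lemma insert_coord_at [simp]: "insert_coord j t y j = t"
  by (simp add: insert_coord_def)

lemma sum_del_coord: "sum (del_coord j x) K = sum x (skip j ` K)"
  unfolding del_coord_eq_comp_skip
  by (rule sum.reindex[OF inj_on_subset[OF inj_skip], symmetric]) simp

lemma card_skip_image: "card (skip j ` K) = card K"
  by (rule card_image[OF inj_on_subset[OF inj_skip]]) simp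

lemma range_skip: "range (skip j) = - {j}"
proof -
  have "i = skip j (if i < j then i else i - 1)" if "i \<noteq> j" for i
    using that by (auto simp: skip_def)
  then show ?thesis by auto
qed

lemma sum_split_coord:
  assumes "finite J"
  shows "sum x J = (if j \<in> J then x j else 0) + sum (del_coord j x) (skip j -` J)"
    and "card J = (if j \<in> J then 1 else 0) + card (skip j -` J)"
proof -
  have image: "skip j ` (skip j -` J) = J - {j}"
    by (simp add: range_skip Diff_eq)
  show "sum x J = (if j \<in> J then x j else 0) + sum (del_coord j x) (skip j -` J)"
    unfolding sum_del_coord image using assms by (simp add: sum_diff1)
  have "card (skip j -` J) = card (J - {j})"
    by (metis card_skip_image image)
  then show "card J = (if j \<in> J then 1 else 0) + card (skip j -` J)"
    using card_Suc_Diff1[OF assms, of j] by auto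
qed

lemma del_coord_mem_orthant_on:
  "j < r \<Longrightarrow> x \<in> orthant_on {..<r} \<Longrightarrow> del_coord j x \<in> orthant_on {..<r - 1}"
  by (auto simp: orthant_on_def del_coord_eq_comp_skip skip_less_iff)

lemma insert_coord_mem_orthant_on:
  "j < r \<Longrightarrow> y \<in> orthant_on {..<r - 1} \<Longrightarrow> 0 \<le> t \<Longrightarrow> insert_coord j t y \<in> orthant_on {..<r}"
  by (auto simp: orthant_on_def insert_coord_def)

lemma proj_del_sim_body:
  assumes "j < r" "decreasing_weights r v"
  shows "proj_del j (sim_body {..<r} v) = sim_body {..<r - 1} v"
  unfolding proj_del_def
proof (intro equalityI subsetI)
  fix y assume "y \<in> del_coord j ` sim_body {..<r} v"
  then obtain x where x: "x \<in> sim_body {..<r} v" and y: "y = del_coord j x" by blast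
  have "sum y K \<le> sum v {..<card K}" if "K \<subseteq> {..<r - 1}" for K
  proof -
    have "skip j ` K \<subseteq> {..<r}" using that skip_less_iff[OF assms(1)] by auto
    then have "sum x (skip j ` K) \<le> sum v {..<card (skip j ` K)}"
      using x unfolding sim_body_def by blast
    then show ?thesis by (simp add: y sum_del_coord card_skip_image)
  qed
  moreover have "y \<in> orthant_on {..<r - 1}"
    using del_coord_mem_orthant_on[OF assms(1)] x y by (simp add: sim_body_def)
  ultimately show "y \<in> sim_body {..<r - 1} v" by (simp add: sim_body_def)
next
  fix y assume y: "y \<in> sim_body {..<r - 1} v"
  let ?x = "insert_coord j 0 y"
  have "sum ?x J \<le> sum v {..<card J}" if J: "J \<subseteq> {..<r}" for J
  proof -
    have fin: "finite J" using J finite_subset by blast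
    have "skip j -` J \<subseteq> {..<r - 1}" using J skip_less_iff[OF assms(1)] by auto
    then have "sum y (skip j -` J) \<le> sum v {..<card (skip j -` J)}"
      using y by (simp add: sim_body_def)
    then have "sum ?x J \<le> sum v {..<card (skip j -` J)}"
      using sum_split_coord(1)[OF fin, of ?x j] by simp
    also have "\<dots> \<le> sum v {..<card J}"
      using sum_split_coord(2)[OF fin, of j] card_mono[OF _ J] decreasing_weightsD(2)[OF assms(2)]
      by (intro sum_mono2) auto
    finally show ?thesis .
  qed
  moreover have "?x \<in> orthant_on {..<r}"
    using insert_coord_mem_orthant_on[OF assms(1)] y by (simp add: sim_body_def)
  ultimately have "?x \<in> sim_body {..<r} v" by (simp add: sim_body_def)
  then show "y \<in> del_coord j ` sim_body {..<r} v"
    using del_coord_insert_coord[of j 0 y] by (rule_tac image_eqI) auto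
qed

lemma slice_sim_body:
  assumes "j < r" "decreasing_weights r v"
  shows "{del_coord j x | x. x \<in> sim_body {..<r} v \<and> x j = v 0}
    = sim_body {..<r - 1} (\<lambda>i. v (Suc i))"
proof (intro equalityI subsetI)
  fix y assume "y \<in> {del_coord j x | x. x \<in> sim_body {..<r} v \<and> x j = v 0}"
  then obtain x where x: "x \<in> sim_body {..<r} v" "x j = v 0" and y: "y = del_coord j x" by blast
  have "sum y K \<le> sum (\<lambda>i. v (Suc i)) {..<card K}" if "K \<subseteq> {..<r - 1}" for K
  proof -
    have fin: "finite K" using that finite_subset by blast
    have "insert j (skip j ` K) \<subseteq> {..<r}" using that skip_less_iff[OF assms(1)] assms(1) by auto
    then have "sum x (insert j (skip j ` K)) \<le> sum v {..<card (insert j (skip j ` K))}"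
      using x(1) unfolding sim_body_def by blast
    moreover have "j \<notin> skip j ` K" using skip_neq by (metis imageE)
    ultimately show ?thesis
      using x(2) fin
      by (simp add: y sum_del_coord card_skip_image sum.lessThan_Suc_shift del: sum.lessThan_Suc)
  qed
  then show "y \<in> sim_body {..<r - 1} (\<lambda>i. v (Suc i))"
    using del_coord_mem_orthant_on[OF assms(1)] x y by (auto simp: sim_body_def)
next
  fix y assume y: "y \<in> sim_body {..<r - 1} (\<lambda>i. v (Suc i))"
  let ?x = "insert_coord j (v 0) y"
  have "sum ?x J \<le> sum v {..<card J}" if J: "J \<subseteq> {..<r}" for J
  proof -
    have fin: "finite J" using J finite_subset by blast
    have sub: "skip j -` J \<subseteq> {..<r - 1}" using J skip_less_iff[OF assms(1)] by auto
    then have le: "sum y (skip j -` J) \<le> sum (\<lambda>i. v (Suc i)) {..<card (skip j -` J)}"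
      using y by (auto simp: sim_body_def)
    show ?thesis
    proof (cases "j \<in> J")
      case True
      then show ?thesis
        using le sum_split_coord(1)[OF fin, of ?x j] sum_split_coord(2)[OF fin, of j]
        by (simp add: sum.lessThan_Suc_shift del: sum.lessThan_Suc)
    next
      case False
      have "sum (\<lambda>i. v (Suc i)) {..<card (skip j -` J)} \<le> sum v {..<card (skip j -` J)}"
        using card_mono[OF _ sub] decreasing_weightsD(1)[OF assms(2)] by (intro sum_mono) auto
      then show ?thesis
        using le False sum_split_coord(1)[OF fin, of ?x j] sum_split_coord(2)[OF fin, of j] by simp
    qed
  qed
  moreover have "?x \<in> orthant_on {..<r}"
    using insert_coord_mem_orthant_on[OF assms(1)] y decreasing_weightsD(2)[OF assms(2)] assms(1)
    by (simp add: sim_body_def)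
  ultimately have "?x \<in> sim_body {..<r} v" by (simp add: sim_body_def)
  then show "y \<in> {del_coord j x | x. x \<in> sim_body {..<r} v \<and> x j = v 0}"
    unfolding mem_Collect_eq by (intro exI[of _ ?x]) simp
qed

lemma coordinate_image_sim_body:
  assumes "finite I" "j \<in> I" "decreasing_weights (card I) v"
  shows "(\<lambda>x. x j) ` sim_body I v = {0..v 0}"
proof (intro equalityI subsetI)
  fix t assume "t \<in> (\<lambda>x. x j) ` sim_body I v"
  then obtain x where x: "x \<in> sim_body I v" and t: "t = x j" by blast
  have "sum x {j} \<le> sum v {..<card {j}}" using x assms(2) unfolding sim_body_def by blast
  moreover have "0 \<le> x j" using x assms(2) by (simp add: sim_body_def orthant_on_def)
  ultimately show "t \<in> {0..v 0}" using t by simp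
next
  fix t assume t: "t \<in> {0..v 0}"
  define x where "x = zero_outside {j} (\<lambda>_. t)"
  have "sum x J \<le> sum v {..<card J}" if J: "J \<subseteq> I" for J
  proof (cases "j \<in> J")
    case True
    have fin: "finite J" using assms(1) J finite_subset by blast
    then have "0 < card J" using True card_gt_0_iff by blast
    then have "sum v {..<card J} = v 0 + sum v {1..<card J}"
      by (simp add: sum.atLeast_Suc_lessThan atLeast0LessThan[symmetric])
    moreover have "0 \<le> sum v {1..<card J}"
      using card_mono[OF assms(1) J] decreasing_weightsD(2)[OF assms(3)] by (intro sum_nonneg) auto
    moreover have "sum x J = t" using True fin by (simp add: x_def zero_outside_def)
    ultimately show ?thesis using t by simp
  next
    case False
    then have "sum x J = 0" by (auto simp: x_def zero_outside_def intro!: sum.neutral)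
    then show ?thesis
      using zero_mem_sim_body[OF assms(1,3)] J by (simp add: sim_body_def)
  qed
  moreover have "x \<in> orthant_on I"
    using t assms(2) by (auto simp: orthant_on_def x_def zero_outside_def)
  ultimately have "x \<in> sim_body I v" by (simp add: sim_body_def)
  moreover have "x j = t" by (simp add: x_def zero_outside_def)
  ultimately show "t \<in> (\<lambda>x. x j) ` sim_body I v" by blast
qed

section \<open>Scaling\<close>

lemma emeasure_lborel_vimage_mult:
  fixes q :: real
  assumes "q > 0" "A \<in> sets borel"
  shows "emeasure lborel ((\<lambda>x. q * x) -` A) = ennreal (1 / q) * emeasure lborel A"
proof -
  have "emeasure lborel ((\<lambda>x. q * x) -` A) = emeasure (distr lborel borel ((*) q)) A"
    using assms(2) by (simp add: emeasure_distr)
  also have "\<dots> = emeasure (density lborel (\<lambda>_. inverse \<bar>q\<bar>)) A"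
    using assms(1) by (simp add: lborel_distr_mult)
  finally show ?thesis
    using assms by (simp add: emeasure_density_const inverse_eq_divide)
qed

lemma PiM_lborel_eq_density_distr_scale:
  fixes q :: real and I :: "'a set"
  assumes "finite I" "q > 0"
  shows "density (distr (\<Pi>\<^sub>M i\<in>I. lborel) (\<Pi>\<^sub>M i\<in>I. lborel) (\<lambda>f. \<lambda>i\<in>I. q * f i))
      (\<lambda>_. ennreal (q ^ card I)) = (\<Pi>\<^sub>M i\<in>I. lborel)"
    (is "density (distr ?M ?M ?T) _ = _")
proof -
  interpret product_sigma_finite "\<lambda>_::'a. lborel :: real measure" by standard
  show ?thesis
  proof (rule PiM_eqI[OF assms(1)])
    fix B :: "'a \<Rightarrow> real set" assume B: "\<And>i. i \<in> I \<Longrightarrow> B i \<in> sets lborel"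
    have box: "Pi\<^sub>E I B \<in> sets ?M" using B by (simp add: sets_PiM_I_finite assms(1))
    have T: "?T \<in> ?M \<rightarrow>\<^sub>M ?M" by measurable
    have pre: "(\<lambda>x. q * x) -` B i \<in> sets lborel" if "i \<in> I" for i
      using measurable_sets_borel[of "\<lambda>x::real. q * x" borel "B i"] B[OF that] by simp
    have "?T -` Pi\<^sub>E I B \<inter> space ?M = Pi\<^sub>E I (\<lambda>i. (\<lambda>x. q * x) -` B i)"
      by (auto simp: space_PiM PiE_def extensional_def Pi_def)
    then have "emeasure (distr ?M ?M ?T) (Pi\<^sub>E I B) = (\<Prod>i\<in>I. emeasure lborel ((\<lambda>x. q * x) -` B i))"
      using B by (simp add: emeasure_distr[OF T box] emeasure_PiM[OF assms(1) pre])
    also have "\<dots> = ennreal (1 / q) ^ card I * (\<Prod>i\<in>I. emeasure lborel (B i))"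
      using B assms(2) by (simp add: emeasure_lborel_vimage_mult prod.distrib)
    finally have "emeasure (density (distr ?M ?M ?T) (\<lambda>_. ennreal (q ^ card I))) (Pi\<^sub>E I B)
        = ennreal (q ^ card I) * ennreal (1 / q) ^ card I * (\<Prod>i\<in>I. emeasure lborel (B i))"
      using box by (simp add: emeasure_density_const mult.assoc)
    also have "ennreal (q ^ card I) * ennreal (1 / q) ^ card I = 1"
      using assms(2) by (simp add: ennreal_power[symmetric] ennreal_mult[symmetric] power_one_over
          flip: power_mult_distrib)
    finally show "emeasure (density (distr ?M ?M ?T) (\<lambda>_. ennreal (q ^ card I))) (Pi\<^sub>E I B)
        = (\<Prod>i\<in>I. emeasure lborel (B i))" by (simp add: restrict_def)
  qed simp
qed

lemma measure_PiM_lborel_scale_image: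
  fixes q :: real and I :: "'a set"
  assumes "finite I" "q > 0" and A: "A \<subseteq> space (\<Pi>\<^sub>M i\<in>I. lborel)"
  shows "measure (\<Pi>\<^sub>M i\<in>I. lborel) ((\<lambda>f. \<lambda>i\<in>I. q * f i) ` A)
      = q ^ card I * measure (\<Pi>\<^sub>M i\<in>I. lborel) A"
    (is "measure ?M (?T ` A) = _")
proof -
  define S where "S = (\<lambda>f::'a \<Rightarrow> real. \<lambda>i\<in>I. f i / q)"
  have T: "?T \<in> ?M \<rightarrow>\<^sub>M ?M" and S: "S \<in> ?M \<rightarrow>\<^sub>M ?M" unfolding S_def by measurable
  have space: "f \<in> space ?M \<longleftrightarrow> (\<forall>i. i \<notin> I \<longrightarrow> f i = undefined)" for f
    by (auto simp: space_PiM PiE_def extensional_def)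
  have image_eq: "?T ` A = S -` A \<inter> space ?M"
  proof (intro equalityI subsetI)
    fix g assume "g \<in> ?T ` A"
    then obtain f where "f \<in> A" "g = ?T f" by blast
    moreover have "S (?T f) = f" using \<open>f \<in> A\<close> A assms(2) by (auto simp: S_def space fun_eq_iff)
    ultimately show "g \<in> S -` A \<inter> space ?M" by (simp add: space)
  next
    fix g assume g: "g \<in> S -` A \<inter> space ?M"
    then have "g = ?T (S g)" using assms(2) by (auto simp: S_def space fun_eq_iff)
    then show "g \<in> ?T ` A" using g by blast
  qed
  have preimage_eq: "?T -` (?T ` A) \<inter> space ?M = A"
  proof (intro equalityI subsetI)
    fix g assume "g \<in> ?T -` (?T ` A) \<inter> space ?M"
    then obtain f where f: "f \<in> A" "?T g = ?T f" "g \<in> space ?M" by auto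
    have "g i = f i" for i
    proof (cases "i \<in> I")
      case True
      then show ?thesis using fun_cong[OF f(2), of i] assms(2) by simp
    qed (use f A in \<open>auto simp: space\<close>)
    then show "g \<in> A" using f(1) by (metis ext)
  qed (use A in auto)
  show ?thesis
  proof (cases "A \<in> sets ?M")
    case True
    then have TA: "?T ` A \<in> sets ?M" unfolding image_eq by (rule measurable_sets[OF S])
    have "emeasure ?M (?T ` A)
        = emeasure (density (distr ?M ?M ?T) (\<lambda>_. ennreal (q ^ card I))) (?T ` A)"
      using PiM_lborel_eq_density_distr_scale[OF assms(1,2)] by simp
    also have "\<dots> = ennreal (q ^ card I) * emeasure ?M A"
      using TA by (simp add: emeasure_density_const emeasure_distr[OF T] preimage_eq)
    finally show ?thesis
      using assms(2) by (simp add: measure_def enn2real_mult)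
  next
    case False
    have "?T ` A \<notin> sets ?M"
      using measurable_sets[OF T, of "?T ` A"] False by (auto simp: preimage_eq)
    then show ?thesis using False by (simp add: measure_notin_sets)
  qed
qed

lemma vol_scaleR:
  assumes "q > 0"
  shows "vol n ((*\<^sub>R) q ` A) = q ^ n * vol n A"
proof -
  have image_eq: "(\<lambda>x. restrict x {..<n}) ` (*\<^sub>R) q ` A
      = (\<lambda>f. \<lambda>i\<in>{..<n}. q * f i) ` (\<lambda>x. restrict x {..<n}) ` A"
    unfolding image_image by (intro image_cong) (auto simp: restrict_def fun_eq_iff)
  have "(\<lambda>x. restrict x {..<n}) ` A \<subseteq> space (\<Pi>\<^sub>M i\<in>{..<n}. lborel)"
    by (auto simp: space_PiM PiE_def extensional_def)
  from measure_PiM_lborel_scale_image[OF finite_lessThan assms this]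
  show ?thesis unfolding vol_def image_eq by simp
qed

lemma proj_del_scaleR: "proj_del j ((*\<^sub>R) q ` A) = (*\<^sub>R) q ` proj_del j A"
proof -
  have "del_coord j \<circ> (*\<^sub>R) q = (*\<^sub>R) q \<circ> del_coord j"
    by (auto simp: del_coord_def fun_eq_iff)
  then show ?thesis unfolding proj_del_def by (metis image_comp)
qed

lemma delta_scaleR:
  assumes "r \<ge> 1" "q > 0"
  shows "delta r (q * k) ((*\<^sub>R) q ` A) = q ^ r * delta r k A"
proof -
  have "q * q ^ (r - 1) = q ^ r" using assms(1) by (simp add: power_eq_if)
  then show ?thesis
    unfolding delta_def proj_del_scaleR vol_scaleR[OF assms(2)]
    by (simp add: algebra_simps flip: sum_distrib_left)
qed

lemma SIM_scale:
  assumes "q > 0"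
  shows "SIM r (\<lambda>i. q * \<alpha> i) = (*\<^sub>R) q ` SIM r \<alpha>"
proof (intro equalityI subsetI)
  fix x assume "x \<in> SIM r (\<lambda>i. q * \<alpha> i)"
  then have "(1 / q) *\<^sub>R x \<in> SIM r \<alpha>"
    using assms by (auto simp: SIM_def orthant_def divide_le_eq mult.commute
        simp flip: sum_divide_distrib sum_distrib_left)
  moreover have "x = q *\<^sub>R ((1 / q) *\<^sub>R x)" using assms by simp
  ultimately show "x \<in> (*\<^sub>R) q ` SIM r \<alpha>" by blast
next
  fix x assume "x \<in> (*\<^sub>R) q ` SIM r \<alpha>"
  then show "x \<in> SIM r (\<lambda>i. q * \<alpha> i)"
    using assms by (auto simp: SIM_def orthant_def simp flip: sum_distrib_left)
qed

theorem lemma13: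
  fixes r :: nat and \<alpha> :: "nat \<Rightarrow> real"
  assumes "r \<ge> 1"
    and "0 < \<alpha> 0"
    and "\<And>i j. i \<le> j \<Longrightarrow> j < r \<Longrightarrow> \<alpha> i \<le> \<alpha> j"
  shows "(\<forall>j<r. axis_length (SIM r \<alpha>) j = \<alpha> (r - 1))
    \<and> SIM r \<alpha> = down_closure r (convex hull (coord_perms r \<alpha>))
    \<and> (\<forall>j<r. {del_coord j x | x. x \<in> SIM r \<alpha> \<and> x j = \<alpha> (r - 1)} = SIM (r - 1) \<alpha>)
    \<and> (\<forall>j<r. proj_del j (SIM r \<alpha>) = SIM (r - 1) (\<lambda>i. \<alpha> (Suc i)))
    \<and> (\<forall>q k. 0 < q \<longrightarrow> 0 < k \<longrightarrow>
         delta r (q * k) (SIM r (\<lambda>i. q * \<alpha> i)) = q ^ r * delta r k (SIM r \<alpha>))"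
proof -
  define v where "v i = \<alpha> (r - 1 - i)" for i
  have dec: "decreasing_weights r v"
    unfolding v_def using assms(2,3) by (intro decreasing_weights_rev) auto
  have SIM: "SIM r \<alpha> = sim_body {..<r} v" by (rule SIM_eq_sim_body) (simp add: v_def)
  have "axis_length (SIM r \<alpha>) j = \<alpha> (r - 1)" if "j < r" for j
    using coordinate_image_sim_body[of "{..<r}" j v] that dec decreasing_weightsD(2)[OF dec, of 0]
    by (simp add: axis_length_def SIM v_def)
  moreover have "SIM r \<alpha> = down_closure r (convex hull (coord_perms r \<alpha>))"
    using sim_body_subset_perm_down_hull[of "{..<r}" v]
      perm_down_hull_subset_sim_body[of "{..<r}" v] dec
    by (simp add: SIM down_closure_def perm_down_hull_def orthant_eq_orthant_on
        coord_perms_eq_perm_vectors v_def[abs_def])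
  moreover have "{del_coord j x | x. x \<in> SIM r \<alpha> \<and> x j = \<alpha> (r - 1)} = SIM (r - 1) \<alpha>"
    if "j < r" for j
    using slice_sim_body[OF that dec] SIM_eq_sim_body[of "r - 1" "\<lambda>i. v (Suc i)" \<alpha>]
    by (simp add: SIM v_def)
  moreover have "proj_del j (SIM r \<alpha>) = SIM (r - 1) (\<lambda>i. \<alpha> (Suc i))" if "j < r" for j
    using proj_del_sim_body[OF that dec] SIM_eq_sim_body[of "r - 1" v "\<lambda>i. \<alpha> (Suc i)"]
    by (simp add: SIM v_def Suc_diff_Suc)
  moreover have "delta r (q * k) (SIM r (\<lambda>i. q * \<alpha> i)) = q ^ r * delta r k (SIM r \<alpha>)"
    if "q > 0" for q k
    using that assms(1) by (simp add: SIM_scale delta_scaleR)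
  ultimately show ?thesis by blast
qed

end
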